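(* For all sufficiently large integers $n$, the period of $n$ has size $O(\log\log n)$: there exist a constant $C>0$ and an integer $N\ge 3$ such that for every integer $n\ge N$ the period $k(n)$ of $n$ satisfies $k(n)\le C\log\log n$.
   Context: For a positive integer $n$, $d(n)$ denotes the number of positive divisors of $n$, and $d^{k}$ denotes the $k$-fold iterate of $d$ (so $d^1=d$ and $d^{k+1}(n)=d(d^{k}(n))$). For an integer $n\ge 2$, the period $k(n)$ of $n$ is the smallest integer $k\ge 1$ such that $d^{k}(n)=2$. *)

theory Defs
  imports Complex_Main
begin

definition divisor_count :: "nat \<Rightarrow> nat" where
  "divisor_count n = card {m. m dvd n}"

text \<open>
  The period is only meaningful for \<open>n \<ge> 2\<close>; lemma \<open>period_exists\<close> below shows that
  the \<open>LEAST\<close> is then taken over a nonempty set.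
\<close>

definition period :: "nat \<Rightarrow> nat" where
  "period n = (LEAST k. k \<ge> 1 \<and> (divisor_count ^^ k) n = 2)"

lemma divisor_count_2: "divisor_count 2 = 2"
proof -
  have "m dvd 2 \<longleftrightarrow> m = 1 \<or> m = 2" for m :: nat
  proof
    assume "m dvd 2"
    then have "m \<le> 2" "m \<noteq> 0" using dvd_imp_le[of m 2] by (auto intro!: Nat.gr0I)
    then show "m = 1 \<or> m = 2" by linarith
  qed auto
  then have "{m::nat. m dvd 2} = {1, 2}" by auto
  then show ?thesis by (simp add: divisor_count_def)
qed

lemma divisor_count_ge_2:
  assumes "n \<ge> 2"
  shows "divisor_count n \<ge> 2"
proof -
  have "card {1, n} \<le> card {m. m dvd n}"
    using assms by (intro card_mono) auto
  then show ?thesis using assms by (simp add: divisor_count_def)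
qed

lemma divisor_count_less:
  assumes "n \<ge> 3"
  shows "divisor_count n < n"
proof -
  have "\<not> (n - 1) dvd n"
  proof
    assume "(n - 1) dvd n"
    then have "(n - 1) dvd (n - (n - 1))" by (rule dvd_diff_nat) simp
    then show False using assms by simp
  qed
  then have "{m. m dvd n} \<subseteq> {1..n} - {n - 1}"
    using assms dvd_imp_le[of _ n] by (auto simp: Suc_le_eq intro!: Nat.gr0I)
  then have "card {m. m dvd n} \<le> card ({1..n} - {n - 1})"
    by (intro card_mono) auto
  also have "\<dots> = n - 1" using assms by (subst card_Diff_singleton) auto
  finally show ?thesis using assms by (simp add: divisor_count_def)
qed

lemma period_exists:
  assumes "n \<ge> 2"
  shows "\<exists>k\<ge>1. (divisor_count ^^ k) n = 2"
  using assms
proof (induction n rule: less_induct)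
  case (less n)
  show ?case
  proof (cases "n = 2")
    case True
    then show ?thesis by (intro exI[of _ 1]) (simp add: divisor_count_2)
  next
    case False
    with less.prems have "n \<ge> 3" by simp
    from less.IH[OF divisor_count_less[OF this] divisor_count_ge_2[OF less.prems]]
    obtain k where "(divisor_count ^^ k) (divisor_count n) = 2" by blast
    then show ?thesis by (intro exI[of _ "Suc k"]) (simp add: funpow_Suc_right del: funpow.simps)
  qed
qed

end

theory Submission
  imports Defs
begin

text \<open>
  Pairing each divisor \<open>m\<close> of \<open>n\<close> with \<open>n div m\<close> gives \<open>d(n) \<le> 2 \<surd>n\<close>. For \<open>n \<ge> 256\<close> this is at
  most \<open>n\<close> to the power \<open>5/8\<close>, so each application of \<open>d\<close> multiplies \<open>log n\<close> by at most \<open>5/8\<close>, and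
  \<open>O(log log n)\<close> steps bring the iterates below \<open>256\<close>. From there the strict decrease of \<open>d\<close> leaves
  boundedly many steps.
\<close>

lemma divisor_count_square_le:
  assumes "n \<ge> 1"
  shows "(divisor_count n)\<^sup>2 \<le> 4 * n"
proof -
  define A where "A = {m. m dvd n \<and> m\<^sup>2 \<le> n}"
  have fin: "finite A"
    using assms by (auto simp: A_def)
  have ne: "A \<noteq> {}"
    using assms by (auto simp: A_def intro!: exI[of _ 1])
  \<comment> \<open>In a factorization \<open>n = m * k\<close> the smaller factor has square at
    most \<open>n\<close>, so it lies in \<open>A\<close>.\<close>
  have "{m. m dvd n} \<subseteq> A \<union> (\<lambda>m. n div m) ` A"
  proof
    fix m assume "m \<in> {m. m dvd n}"
    then obtain k where k: "n = m * k" by auto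
    show "m \<in> A \<union> (\<lambda>m. n div m) ` A"
    proof (cases "m \<le> k")
      case True
      then have "m \<in> A" using k by (simp add: A_def power2_eq_square)
      then show ?thesis by blast
    next
      case False
      then have "k \<in> A" using k by (simp add: A_def power2_eq_square)
      moreover have "m = n div k" using k assms by auto
      ultimately show ?thesis by blast
    qed
  qed
  then have "divisor_count n \<le> card (A \<union> (\<lambda>m. n div m) ` A)"
    unfolding divisor_count_def using fin by (intro card_mono) auto
  also have "\<dots> \<le> 2 * card A"
    using card_Un_le[of A "(\<lambda>m. n div m) ` A"] card_image_le[OF fin, of "\<lambda>m. n div m"] by linarith
  \<comment> \<open>Bounding \<open>card A\<close> by \<open>Max A\<close>, whose square is at most
    \<open>n\<close>, keeps the argument in the naturals, without square roots.\<close>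
  also have "card A \<le> card {1..Max A}"
    using fin assms by (intro card_mono) (auto simp: A_def Suc_le_eq intro!: Nat.gr0I)
  finally have "divisor_count n \<le> 2 * Max A" by simp
  then have "(divisor_count n)\<^sup>2 \<le> (2 * Max A)\<^sup>2"
    by (rule power_mono) simp
  moreover have "(Max A)\<^sup>2 \<le> n"
    using Max_in[OF fin ne] by (simp add: A_def)
  ultimately show ?thesis by (simp add: power_mult_distrib)
qed

text \<open>Since 256 is the fourth power of 4, \<open>ln 4\<close> is at most a quarter of
  \<open>ln n\<close>; halving \<open>ln 4 + ln n\<close> then gives the factor 5/8.\<close>

lemma ln_divisor_count_le:
  assumes "n \<ge> 256"
  shows "ln (real (divisor_count n)) \<le> 5 / 8 * ln (real n)"
proof -
  have pos: "real (divisor_count n) > 0"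
    using divisor_count_ge_2[of n] assms by simp
  have "real ((divisor_count n)\<^sup>2) \<le> real (4 * n)"
    using divisor_count_square_le[of n] assms by (intro of_nat_mono) simp
  then have "ln ((real (divisor_count n))\<^sup>2) \<le> ln (4 * real n)"
    using pos assms by (subst ln_le_cancel_iff) simp_all
  then have "2 * ln (real (divisor_count n)) \<le> ln 4 + ln (real n)"
    using pos assms by (simp add: ln_realpow ln_mult)
  moreover have "4 * ln (4::real) = ln 256"
    using ln_realpow[of "4::real" 4] by simp
  moreover have "ln (256::real) \<le> ln (real n)"
    using assms by (subst ln_le_cancel_iff) simp_all
  ultimately show ?thesis by simp
qed

text \<open>Equality fails at \<open>n = 2\<close>: as \<open>period\<close> requires
  \<open>k \<ge> 1\<close>, both periods are 1 there.\<close>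

lemma period_le_Suc_period_divisor_count:
  assumes "n \<ge> 2"
  shows "period n \<le> Suc (period (divisor_count n))"
proof -
  have "(divisor_count ^^ period (divisor_count n)) (divisor_count n) = 2"
    unfolding period_def
    using LeastI_ex[OF period_exists[OF divisor_count_ge_2[OF assms]]] by blast
  then show ?thesis
    unfolding period_def[of n]
    by (intro Least_le) (simp add: funpow_Suc_right del: funpow.simps)
qed

text \<open>A crude bound from the strict decrease of \<open>d\<close>, meant for iterates below
  256.\<close>

lemma period_le_self:
  assumes "n \<ge> 2"
  shows "period n \<le> n"
  using assms
proof (induction n rule: less_induct)
  case (less n)
  show ?case
  proof (cases "n = 2")
    case True
    have "period 2 \<le> 1"
      unfolding period_def by (intro Least_le) (simp add: divisor_count_2)
    with True show ?thesis by simp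
  next
    case False
    with less.prems have "divisor_count n < n" by (intro divisor_count_less) simp
    then show ?thesis
      using less.IH[of "divisor_count n"] divisor_count_ge_2[OF less.prems]
        period_le_Suc_period_divisor_count[OF less.prems] by linarith
  qed
qed

lemma ln_ln_ge_1:
  assumes "n \<ge> 256"
  shows "1 \<le> ln (ln (real n))"
proof -
  \<comment> \<open>From \<open>ln (1/2) \<le> -1/2\<close> follows \<open>8 * ln 2 \<ge> 4\<close>,
    while \<open>exp 1 \<le> 3\<close>.\<close>
  have "exp 1 \<le> 8 * ln (2::real)"
    using exp_le ln_le_minus_one[of "1 / 2 :: real"] by (simp add: ln_div)
  also have "\<dots> = ln 256"
    using ln_realpow[of "2::real" 8] by simp
  also have "\<dots> \<le> ln (real n)"
    using assms by (subst ln_le_cancel_iff) simp_all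
  finally have "ln (exp 1) \<le> ln (ln (real n))"
    using less_le_trans[OF exp_gt_zero] by (subst ln_le_cancel_iff) simp_all
  then show ?thesis by simp
qed

lemma period_le_ln_ln:
  assumes "n \<ge> 256"
  shows "real (period n) \<le> 257 + 3 * ln (ln (real n))"
  using assms
proof (induction n rule: less_induct)
  case (less n)
  define m where "m = divisor_count n"
  have m: "m \<ge> 2" "m < n"
    using divisor_count_ge_2[of n] divisor_count_less[of n] less.prems by (simp_all add: m_def)
  have step: "period n \<le> Suc (period m)"
    using period_le_Suc_period_divisor_count[of n] less.prems by (simp add: m_def)
  show ?case
  proof (cases "m < 256")
    case True
    \<comment> \<open>Here \<open>m \<le> 255\<close>, so \<open>period n \<le> 256\<close>, and the
      double logarithm is nonnegative.\<close>
    then show ?thesis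
      using step period_le_self[OF m(1)] ln_ln_ge_1[OF less.prems] by linarith
  next
    case False
    have ln_pos: "ln (real m) > 0" "ln (real n) > 0"
      using m by simp_all
    have "ln (ln (real m)) \<le> ln (5 / 8 * ln (real n))"
      using ln_divisor_count_le[OF less.prems] ln_pos
      by (subst ln_le_cancel_iff) (simp_all add: m_def)
    also have "\<dots> = ln (5 / 8) + ln (ln (real n))"
      using ln_pos by (intro ln_mult_pos) simp_all
    \<comment> \<open>The coefficient 3 turns this drop of 3/8 into 9/8, which pays for the one
      extra application of \<open>d\<close>.\<close>
    also have "ln (5 / 8 :: real) \<le> - 3 / 8"
      using ln_le_minus_one[of "5 / 8 :: real"] by simp
    finally show ?thesis
      using step less.IH[OF m(2)] False by simp
  qed
qed

theorem theorem3:
  shows "\<exists>C::real. C > 0 \<and> (\<exists>N::nat. N \<ge> 3 \<and>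
           (\<forall>n::nat. n \<ge> N \<longrightarrow> real (period n) \<le> C * ln (ln (real n))))"
proof (rule exI[of _ 260], intro conjI exI[of _ 256] allI impI)
  fix n :: nat
  assume "n \<ge> 256"
  \<comment> \<open>As the double logarithm is at least 1, it absorbs the constant: 257 + 3 =
    260.\<close>
  then show "real (period n) \<le> 260 * ln (ln (real n))"
    using period_le_ln_ln[of n] ln_ln_ge_1[of n] by linarith
qed simp_all

end
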